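(* Let $F$ be a finite collection of max-T convex sets in $[0,1]^d$, where $T$ is a continuous $T$-norm. If every $d+1$ members of $F$ have a nonempty intersection, then the whole collection has a nonempty intersection.
   Context: A $T$-norm is a function $T:[0,1]^2\to[0,1]$ such that for all $x,y,z\in[0,1]$: $T(x,T(y,z))=T(T(x,y),z)$; $T(x,y)\le T(x,z)$ and $T(y,x)\le T(z,x)$ whenever $y\le z$; $T(x,1)=T(1,x)=x$. It is continuous if $\lim_n T(x_n,y_n)=T(\lim_n x_n,\lim_n y_n)$ for all convergent sequences $(x_n),(y_n)$ in $[0,1]$. Put $a\oplus b=\max(a,b)$ and $a\otimes_T b=T(a,b)$; $\oplus$ acts on vectors of $[0,1]^d$ componentwise and $(\lambda\otimes_T x)_k=T(\lambda,x_k)$. A set $C\subseteq[0,1]^d$ is max-T convex if for all $x,y\in C$ and $\lambda,\mu\in[0,1]$ with $\lambda\oplus\mu=1$ one has $\lambda\otimes_T x\oplus\mu\otimes_T y\in C$. *)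

theory Defs
  imports "HOL-Analysis.Analysis"
begin

text \<open>Norms on the unit interval are total functions on the reals that are only constrained, and
  only ever used, on \<open>{0..1}\<close>. Commutativity is deliberately not part of the definition.\<close>

definition tnorm :: "(real \<Rightarrow> real \<Rightarrow> real) \<Rightarrow> bool" where
  "tnorm T \<longleftrightarrow>
     (\<forall>x\<in>{0..1}. \<forall>y\<in>{0..1}. T x y \<in> {0..1}) \<and>
     (\<forall>x\<in>{0..1}. \<forall>y\<in>{0..1}. \<forall>z\<in>{0..1}. T x (T y z) = T (T x y) z) \<and>
     (\<forall>x\<in>{0..1}. \<forall>y\<in>{0..1}. \<forall>z\<in>{0..1}. y \<le> z \<longrightarrow> T x y \<le> T x z \<and> T y x \<le> T z x) \<and>
     (\<forall>x\<in>{0..1}. T x 1 = x \<and> T 1 x = x)"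

definition continuous_tnorm :: "(real \<Rightarrow> real \<Rightarrow> real) \<Rightarrow> bool" where
  "continuous_tnorm T \<longleftrightarrow>
     tnorm T \<and> continuous_on ({0..1} \<times> {0..1}) (\<lambda>(x, y). T x y)"

text \<open>Continuity on the unit square agrees with the sequential formulation.\<close>

lemma continuous_tnorm_sequentially:
  "continuous_tnorm T \<longleftrightarrow> tnorm T \<and>
     (\<forall>x y a b. (\<forall>n. x n \<in> {0..1}) \<and> (\<forall>n. y n \<in> {0..1}) \<and> x \<longlonglongrightarrow> a \<and> y \<longlonglongrightarrow> b
        \<longrightarrow> (\<lambda>n. T (x n) (y n)) \<longlonglongrightarrow> T a b)"
  (is "_ \<longleftrightarrow> _ \<and> ?seq")
proof -
  have "continuous_on ({0..1} \<times> {0..1}) (\<lambda>(x, y). T x y) \<longleftrightarrow> ?seq" (is "?cont \<longleftrightarrow> _")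
  proof
    assume cont: ?cont
    show ?seq
    proof (intro allI impI, elim conjE)
      fix x y :: "nat \<Rightarrow> real" and a b :: real
      assume x: "\<forall>n. x n \<in> {0..1}" "x \<longlonglongrightarrow> a" and y: "\<forall>n. y n \<in> {0..1}" "y \<longlonglongrightarrow> b"
      have "a \<in> {0..1}" "b \<in> {0..1}"
        using closed_sequentially[OF closed_atLeastAtMost] x y by blast+
      moreover have "(\<lambda>n. (x n, y n)) \<longlonglongrightarrow> (a, b)"
        using x y by (intro tendsto_Pair)
      ultimately show "(\<lambda>n. T (x n) (y n)) \<longlonglongrightarrow> T a b"
        using continuous_on_tendsto_compose[OF cont, of "\<lambda>n. (x n, y n)" "(a, b)" sequentially] x y
        by simp
    qed
  next
    assume seq: ?seq
    show ?cont
      unfolding continuous_on_sequentially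
    proof (intro allI ballI impI, elim conjE)
      fix p :: "nat \<Rightarrow> real \<times> real" and q
      assume p: "\<forall>n. p n \<in> {0..1} \<times> {0..1}" "p \<longlonglongrightarrow> q"
      have "(\<lambda>n. T (fst (p n)) (snd (p n))) \<longlonglongrightarrow> T (fst q) (snd q)"
        using seq[rule_format, of "\<lambda>n. fst (p n)" "\<lambda>n. snd (p n)" "fst q" "snd q"] p
        by (auto simp: mem_Times_iff intro: tendsto_fst tendsto_snd)
      then show "((\<lambda>(x, y). T x y) \<circ> p) \<longlonglongrightarrow> (\<lambda>(x, y). T x y) q"
        by (simp add: o_def case_prod_unfold)
    qed
  qed
  then show ?thesis by (simp add: continuous_tnorm_def)
qed

definition unit_cube :: "(real ^ 'n) set" where
  "unit_cube = {x. \<forall>k. x $ k \<in> {0..1}}"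

definition max_vec :: "real ^ 'n \<Rightarrow> real ^ 'n \<Rightarrow> real ^ 'n" where
  "max_vec x y = (\<chi> k. max (x $ k) (y $ k))"

definition scale_vec :: "(real \<Rightarrow> real \<Rightarrow> real) \<Rightarrow> real \<Rightarrow> real ^ 'n \<Rightarrow> real ^ 'n" where
  "scale_vec T l x = (\<chi> k. T l (x $ k))"

definition max_T_convex :: "(real \<Rightarrow> real \<Rightarrow> real) \<Rightarrow> (real ^ 'n) set \<Rightarrow> bool" where
  "max_T_convex T C \<longleftrightarrow>
     C \<subseteq> unit_cube \<and>
     (\<forall>x\<in>C. \<forall>y\<in>C. \<forall>l\<in>{0..1}. \<forall>m\<in>{0..1}.
        max l m = 1 \<longrightarrow> max_vec (scale_vec T l x) (scale_vec T m y) \<in> C)"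

text \<open>``Every \<open>k\<close> members have a common point'' allows repeated members: otherwise the condition
  would be vacuous for collections of fewer than \<open>k\<close> sets.\<close>

definition every_members_intersect :: "nat \<Rightarrow> 'a set set \<Rightarrow> bool" where
  "every_members_intersect k F \<longleftrightarrow> (\<forall>G. G \<subseteq> F \<and> finite G \<and> card G \<le> k \<longrightarrow> \<Inter>G \<noteq> {})"

lemma every_members_intersect_iff_card_eq:
  assumes "finite F" "k \<le> card F"
  shows "every_members_intersect k F \<longleftrightarrow> (\<forall>G. G \<subseteq> F \<and> card G = k \<longrightarrow> \<Inter>G \<noteq> {})"
proof
  assume "every_members_intersect k F"
  then show "\<forall>G. G \<subseteq> F \<and> card G = k \<longrightarrow> \<Inter>G \<noteq> {}"
    using assms(1) finite_subset unfolding every_members_intersect_def by blast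
next
  assume eq: "\<forall>G. G \<subseteq> F \<and> card G = k \<longrightarrow> \<Inter>G \<noteq> {}"
  show "every_members_intersect k F"
    unfolding every_members_intersect_def
  proof (intro allI impI, elim conjE)
    fix G assume "G \<subseteq> F" "card G \<le> k"
    then obtain H where "G \<subseteq> H" "H \<subseteq> F" "card H = k"
      using exists_subset_between[of G k F] assms by blast
    then show "\<Inter>G \<noteq> {}" using eq by (metis Inter_anti_mono subset_empty)
  qed
qed

end

theory Submission
  imports Defs
begin

text \<open>Choose \<open>d + 2\<close> members \<open>u i\<close> of a family \<open>G\<close> whose proper subfamilies all intersect, and points
  \<open>x i\<close> common to \<open>G - {u i}\<close>. It suffices to find weights \<open>l\<close>, with maximum 1 attained twice, such
  that in each coordinate the maximum of \<open>T (l i) (x i)\<close> is also attained twice: the max-T combination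
  of the \<open>x i\<close> is then unchanged when any one point is dropped, so it lies in every member of \<open>G\<close>.
  These are \<open>d + 1\<close> conditions on \<open>d + 2\<close> weights. A weight that is the only maximiser in some row
  has positive excess; lowering such weights, and raising all weights while none of them is 1, is a
  continuous self-map of the cube, and its Brouwer fixed point has no excess, because a row
  has at most one strict maximiser.\<close>

lemma balanced_weights_exist:
  fixes f :: "'r::finite \<Rightarrow> 'm::finite \<Rightarrow> real \<Rightarrow> real"
  assumes card: "CARD('r) < CARD('m)"
    and cont: "\<And>k i. continuous_on {0..1} (f k i)"
    and zero: "\<And>k i j s. s \<in> {0..1} \<Longrightarrow> f k i 0 \<le> f k j s"
  obtains l :: "real ^ 'm" where "\<And>i. l $ i \<in> {0..1}" "\<exists>i. l $ i = 1"
    "\<And>k i. \<exists>j. j \<noteq> i \<and> f k i (l $ i) \<le> f k j (l $ j)"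
proof -
  \<comment> \<open>The product is positive exactly when \<open>i\<close> is the strict maximiser of
    row \<open>k\<close>; positive parts keep this test continuous in \<open>l\<close>.\<close>
  define excess where "excess l i =
      (\<Sum>k\<in>UNIV. \<Prod>j\<in>UNIV - {i}. max 0 (f k i (l $ i) - f k j (l $ j)))" for l :: "real ^ 'm" and i
  define slack where "slack l = (\<Prod>j\<in>UNIV. 1 - l $ j)" for l :: "real ^ 'm"
  define \<Phi> where "\<Phi> l = (\<chi> i. max 0 (l $ i - excess l i + slack l))" for l :: "real ^ 'm"
  let ?K = "cbox 0 (1 :: real ^ 'm)"
  have pos_iff: "max 0 (a - b) = 0 \<longleftrightarrow> \<not> b < a" for a b :: real by auto
  have K: "l \<in> ?K \<longleftrightarrow> (\<forall>i. l $ i \<in> {0..1})" for l :: "real ^ 'm"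
    by (simp add: mem_box_cart)
  have excess_nonneg: "excess l i \<ge> 0" for l i
    unfolding excess_def by (intro sum_nonneg prod_nonneg) simp
  have contf: "continuous_on ?K (\<lambda>l. f k i (l $ i))" for k i
    by (rule continuous_on_compose2[OF cont]) (auto intro!: continuous_intros simp: K)
  have "continuous_on ?K \<Phi>"
    unfolding \<Phi>_def excess_def slack_def
    by (intro continuous_intros contf)
  moreover have "\<Phi> \<in> ?K \<rightarrow> ?K"
  proof
    fix l assume l: "l \<in> ?K"
    have "\<Phi> l $ i \<in> {0..1}" for i
    proof -
      \<comment> \<open>Splitting off factor \<open>i\<close> gives \<open>slack l\<close> \<le>
        \<open>1 - l $ i\<close>, so raising by \<open>slack\<close> never pushes a weight above
        1.\<close>
      have "slack l = (1 - l $ i) * (\<Prod>j\<in>UNIV - {i}. 1 - l $ j)"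
        unfolding slack_def by (simp add: prod.remove)
      also have "\<dots> \<le> (1 - l $ i) * 1"
        using l by (intro mult_left_mono prod_le_1) (auto simp: K)
      finally show ?thesis
        using excess_nonneg[of l i] l by (simp add: \<Phi>_def K)
    qed
    then show "\<Phi> l \<in> ?K" by (simp add: K)
  qed
  moreover have "?K \<noteq> {}" using K[of 0] by auto
  ultimately obtain l where l: "l \<in> ?K" and fixed: "\<Phi> l = l"
    using brouwer[OF compact_cbox convex_box(1)] by metis
  have l01: "l $ i \<in> {0..1}" for i using l K by blast
  have fix_i: "max 0 (l $ i - excess l i + slack l) = l $ i" for i
    using arg_cong[OF fixed, of "\<lambda>v. v $ i"] by (simp add: \<Phi>_def)
  \<comment> \<open>The truncation at 0 in \<open>\<Phi>\<close> could hide a positive excess of a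
    zero weight. By \<open>zero\<close>, such a weight never strictly beats another index.\<close>
  have excess_0: "excess l i = 0" if "l $ i = 0" for i
  proof -
    have "1 < CARD('m)"
      using card zero_less_card_finite[where 'a = 'r] by linarith
    then have "UNIV \<noteq> {i}"
      by (metis card_1_singleton_iff One_nat_def less_irrefl)
    then obtain j where "j \<noteq> i" by blast
    then show ?thesis
      unfolding excess_def using zero l01 that
      by (intro sum.neutral ballI prod_zero) (auto intro!: bexI[of _ j])
  qed
  have "slack l \<ge> 0"
    unfolding slack_def using l01 by (intro prod_nonneg) auto
  have slack: "slack l = 0"
  proof (rule ccontr)
    assume "slack l \<noteq> 0"
    with \<open>slack l \<ge> 0\<close> have pos: "slack l > 0" by simp
    \<comment> \<open>A zero weight would have no excess and be raised by \<open>slack\<close>, so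
      it is not fixed; a positive weight is fixed only if its excess equals
      \<open>slack\<close>.\<close>
    have "excess l i > 0" for i
      using fix_i[of i] excess_0[of i] pos by (auto simp: max_def split: if_splits)
    then have "excess l i \<noteq> 0" for i
      by (metis less_irrefl)
    then have strict: "\<exists>k. (\<Prod>j\<in>UNIV - {i}. max 0 (f k i (l $ i) - f k j (l $ j))) \<noteq> 0" for i
      unfolding excess_def by (meson sum.not_neutral_contains_not_neutral)
    have "\<exists>k. \<forall>j. j \<noteq> i \<longrightarrow> f k j (l $ j) < f k i (l $ i)" for i
      using strict[of i] by (simp add: pos_iff) blast
    then obtain \<kappa> where \<kappa>: "\<And>i j. j \<noteq> i \<Longrightarrow> f (\<kappa> i) j (l $ j) < f (\<kappa> i) i (l $ i)"
      by metis
    have "inj \<kappa>"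
      by (rule injI) (metis \<kappa> less_asym)
    then have "CARD('m) \<le> CARD('r)"
      using card_inj_on_le[of \<kappa> UNIV UNIV] by simp
    with card show False by simp
  qed
  \<comment> \<open>With no slack, a positive weight is fixed only if its excess vanishes; zero
    weights are covered by \<open>excess_0\<close>.\<close>
  have "excess l i = 0" for i
    using fix_i[of i] excess_0[of i] excess_nonneg[of l i] slack by (auto simp: max_def split: if_splits)
  then have no_excess: "(\<Prod>j\<in>UNIV - {i}. max 0 (f k i (l $ i) - f k j (l $ j))) = 0" for k i
    unfolding excess_def by (subst (asm) sum_nonneg_eq_0_iff) (auto intro: prod_nonneg)
  have "\<exists>j. j \<noteq> i \<and> f k i (l $ i) \<le> f k j (l $ j)" for k i
    using no_excess[of k i] by (auto simp: pos_iff not_less)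
  moreover have "\<exists>i. l $ i = 1"
    using slack by (auto simp: slack_def)
  ultimately show thesis using l01 by (intro that[of l])
qed

lemma tnorm_0_left:
  assumes "tnorm T" "x \<in> {0..1}"
  shows "T 0 x = 0"
proof -
  have mono: "\<forall>x\<in>{0..1}. \<forall>y\<in>{0..1}. \<forall>z\<in>{0..1}. y \<le> z \<longrightarrow> T x y \<le> T x z \<and> T y x \<le> T z x"
    using assms(1) unfolding tnorm_def by blast
  have "T 0 x \<le> T 0 1"
    using mono[rule_format, of 0 x 1] assms(2) by simp
  moreover have "T 0 1 = 0" "0 \<le> T 0 x"
    using assms unfolding tnorm_def by simp_all
  ultimately show ?thesis by simp
qed

lemma continuous_tnorm_left:
  assumes "continuous_tnorm T" "x \<in> {0..1}"
  shows "continuous_on {0..1} (\<lambda>s. T s x)"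
proof -
  have "continuous_on {0..1} (\<lambda>s. (\<lambda>(x, y). T x y) (s, x))"
    using assms unfolding continuous_tnorm_def
    by (intro continuous_on_compose2[of "{0..1} \<times> {0..1}" "\<lambda>(x, y). T x y" _ "\<lambda>s. (s, x)"])
      (auto intro!: continuous_intros)
  then show ?thesis by simp
qed

text \<open>Points are joined one at a time. Since \<open>i\<close> with weight 1 stays in the index
  set, the partial maximum is itself a point of \<open>C\<close> and may be given weight 1, leaving
  any weight \<open>l a\<close> for the next point.\<close>

lemma max_T_convex_combination:
  fixes x :: "'i \<Rightarrow> real ^ 'n"
  assumes T: "tnorm T" and C: "max_T_convex T C" and "finite S"
    and x: "\<And>i. i \<in> S \<Longrightarrow> x i \<in> C" and l: "\<And>i. i \<in> S \<Longrightarrow> l i \<in> {0..1}"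
    and i: "i \<in> S" "l i = 1"
  shows "(\<chi> k. MAX j\<in>S. T (l j) (x j $ k)) \<in> C"
proof -
  have scale_1: "scale_vec T 1 y = y" if "y \<in> C" for y
    using T C that unfolding tnorm_def max_T_convex_def unit_cube_def scale_vec_def
    by (fastforce simp: vec_eq_iff)
  have "(\<chi> k. MAX j\<in>insert i A. T (l j) (x j $ k)) \<in> C" if "finite A" "A \<subseteq> S" for A
    using that
  proof induction
    case empty
    have "scale_vec T 1 (x i) \<in> C" using scale_1 x i by simp
    then show ?case using i by (simp add: scale_vec_def)
  next
    case (insert a A)
    let ?y = "\<chi> k. MAX j\<in>insert i A. T (l j) (x j $ k)"
    have "max_vec (scale_vec T (l a) (x a)) (scale_vec T 1 ?y) \<in> C"
      using C insert x[of a] l[of a] unfolding max_T_convex_def by auto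
    moreover have "max_vec (scale_vec T (l a) (x a)) (scale_vec T 1 ?y)
        = (\<chi> k. MAX j\<in>insert i (insert a A). T (l j) (x j $ k))"
      using scale_1[of ?y] insert
      by (simp add: max_vec_def scale_vec_def insert_commute[of i a] vec_eq_iff del: Max_insert)
        (simp add: insert_commute[of i a])
    ultimately show ?case by simp
  qed
  from this[of S] show ?thesis using \<open>finite S\<close> i by (simp add: insert_absorb)
qed

lemma Max_remove_dominated:
  fixes g :: "'a \<Rightarrow> 'b::linorder"
  assumes "finite S" "j \<in> S" "j \<noteq> i" "g i \<le> g j"
  shows "(MAX a\<in>S - {i}. g a) = (MAX a\<in>S. g a)"
proof (cases "i \<in> S")
  case True
  have "g i \<le> (MAX a\<in>S - {i}. g a)"
    using assms by (intro order_trans[OF assms(4)] Max_ge) auto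
  moreover have "(MAX a\<in>S. g a) = max (g i) (MAX a\<in>S - {i}. g a)"
    using assms True by (subst insert_Diff[OF True, symmetric], subst image_insert, subst Max_insert) auto
  ultimately show ?thesis by simp
qed simp

lemma max_T_convex_Inter_step:
  fixes G :: "(real ^ 'n) set set"
  assumes T: "continuous_tnorm T" and "finite G" and convex: "\<And>C. C \<in> G \<Longrightarrow> max_T_convex T C"
    and card: "CARD('n) + 2 \<le> card G" and proper: "\<And>C. C \<in> G \<Longrightarrow> \<Inter>(G - {C}) \<noteq> {}"
  shows "\<Inter>G \<noteq> {}"
proof -
  have tn: "tnorm T" using T by (simp add: continuous_tnorm_def)
  \<comment> \<open>The type \<open>'n option option\<close> has exactly d + 2 elements and serves
    as the index set of the weights.\<close>
  obtain u :: "'n option option \<Rightarrow> (real ^ 'n) set" where u: "range u \<subseteq> G" "inj u"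
    using card_le_inj[of "UNIV :: 'n option option set" G] \<open>finite G\<close> card by auto
  have "\<exists>x. \<forall>C\<in>G. C \<noteq> u i \<longrightarrow> x \<in> C" for i
    using proper[of "u i"] u(1) by blast
  then obtain x where x: "\<And>i C. C \<in> G \<Longrightarrow> C \<noteq> u i \<Longrightarrow> x i \<in> C"
    by metis
  have cube: "x i $ k \<in> {0..1}" for i k
  proof -
    obtain j where "j \<noteq> i" by (metis option.distinct(1))
    then have "x i \<in> u j" "max_T_convex T (u j)"
      using x[of "u j" i] u convex by (auto simp: inj_eq)
    then show ?thesis unfolding max_T_convex_def unit_cube_def by blast
  qed
  \<comment> \<open>Row \<open>None\<close> compares the weights themselves, so its tie yields a
    second weight equal to 1; row \<open>Some k\<close> compares the \<open>k\<close>-th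
    coordinates.\<close>
  define f where "f k i s = (case k of None \<Rightarrow> s | Some k \<Rightarrow> T s (x i $ k))" for k i s
  obtain l where l01: "\<And>i. l $ i \<in> {0..1}" and l1: "\<exists>i. l $ i = 1"
    and tie: "\<And>k i. \<exists>j. j \<noteq> i \<and> f k i (l $ i) \<le> f k j (l $ j)"
  proof (rule balanced_weights_exist[of f])
    show "CARD('n option) < CARD('n option option)" by simp
    show "continuous_on {0..1} (f k i)" for k i
      unfolding f_def using continuous_tnorm_left[OF T cube] by (cases k) auto
    show "f k i 0 \<le> f k j s" if "s \<in> {0..1}" for k i j s
      using that tn cube[of i] cube[of j] tnorm_0_left[OF tn cube]
      by (auto simp: f_def tnorm_def split: option.split)
  qed blast
  let ?p = "\<chi> k. MAX i. T (l $ i) (x i $ k)"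
  have drop: "?p = (\<chi> k. MAX i\<in>UNIV - {a}. T (l $ i) (x i $ k))" for a
  proof -
    have "(MAX i\<in>UNIV - {a}. T (l $ i) (x i $ k)) = (MAX i. T (l $ i) (x i $ k))" for k
      using tie[of a "Some k"] by (auto simp: f_def intro: Max_remove_dominated)
    then show ?thesis by simp
  qed
  have "?p \<in> C" if "C \<in> G" for C
  proof -
    \<comment> \<open>As \<open>u\<close> is injective, at most one index \<open>a\<close> has
      \<open>u a = C\<close>; if there is none, any \<open>a\<close> serves. Every
      \<open>x i\<close> with \<open>i\<close> \<noteq> \<open>a\<close> then lies in
      \<open>C\<close>.\<close>
    obtain a where a: "\<And>i. i \<noteq> a \<Longrightarrow> C \<noteq> u i"
      using u(2) by (metis inj_eq)
    obtain i where "l $ i = 1" using l1 by blast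
    moreover obtain j where "j \<noteq> i" "l $ i \<le> l $ j"
      using tie[of i None] by (auto simp: f_def)
    \<comment> \<open>Both \<open>i\<close> and \<open>j\<close> have weight 1, and at least one of
      them survives dropping \<open>a\<close>.\<close>
    ultimately obtain b where "b \<noteq> a" "l $ b = 1"
      using l01[of j] by (metis atLeastAtMost_iff order_antisym)
    then show ?thesis
      unfolding drop[of a]
      by (intro max_T_convex_combination[OF tn convex[OF that], where i = b] x[OF that] l01 a) auto
  qed
  then show ?thesis by blast
qed

theorem theorem14:
  fixes T :: "real \<Rightarrow> real \<Rightarrow> real" and F :: "(real ^ 'n) set set"
  assumes "continuous_tnorm T"
    and "finite F"
    and "\<And>C. C \<in> F \<Longrightarrow> max_T_convex T C"
    and "every_members_intersect (CARD('n) + 1) F"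
  shows "\<Inter>F \<noteq> {}"
proof -
  \<comment> \<open>Passing to all subfamilies lets induction supply common points of each
    \<open>G - {C}\<close>; families of at most d + 1 sets are the base case.\<close>
  have "\<Inter>G \<noteq> {}" if "finite G" "G \<subseteq> F" for G
    using that
  proof (induction rule: finite_psubset_induct)
    case (psubset G)
    show ?case
    proof (cases "card G \<le> CARD('n) + 1")
      case True
      then show ?thesis
        using assms(4) psubset unfolding every_members_intersect_def by blast
    next
      case False
      have "\<Inter>(G - {C}) \<noteq> {}" if "C \<in> G" for C
        using psubset.IH[of "G - {C}"] psubset.prems that by blast
      moreover have "max_T_convex T C" if "C \<in> G" for C
        using assms(3) psubset.prems that by blast
      ultimately show ?thesis
        using False by (intro max_T_convex_Inter_step[OF assms(1) psubset.hyps]) simp_all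
    qed
  qed
  then show ?thesis using assms(2) by blast
qed

end
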